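(* Let $H$ be the Hermitian Hamiltonian of a quantum many-body system with non-degenerate normalized ground state $|0\rangle$ of energy $E_0$, and write $\langle X\rangle=\langle 0|X|0\rangle$. Let $G=(E_0-H)^{-1}$ be the resolvent (with the ground state projected out). Let $A(x)$, $B(y)$, $C(x)$ be Hermitian operators located at positions $x$, $y$, $x$ respectively, all with vanishing ground-state expectation value, and suppose that $A(x)$ is proportional to the time derivative of $C(x)$, $A(x)=\kappa\,\partial_t C(x)=\kappa\, i[H,C(x)]$ with $\kappa$ a real constant. Then $$\langle A(x)\,G\,B(y)\rangle+\text{h.c.}=\kappa\, i\,\langle [C(x),B(y)]\rangle ,$$ and this vanishes whenever $|x-y|$ is sufficiently large that $C(x)$ and $B(y)$ commute due to disjoint support. Moreover, for such $x,y$, while the Hermitian combination $\langle A(x)\,G\,B(y)\rangle+\text{h.c.}$ vanishes in general, the individual causation function $\langle A(x)\,G\,B(y)\rangle$ itself vanishes when $H$ is time-reversal symmetric and $A(x)$ and $B(y)$ have the same $T$-charge.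
   Context: With $P_{gs}=|0\rangle\langle 0|$ the ground-state projector, the resolvent $G$ satisfies $(E_0-H)G=\mathbb{I}-P_{gs}$, where $G$ projects out the ground state. The quantity $\langle A(x)\,G\,B(y)\rangle$ is called the causation function of $A(x)$ and $B(y)$; the combination $\langle A(x)\,G\,B(y)\rangle+\text{h.c.}$ (the number plus its complex conjugate) is proportional to $\lim_{\lambda\to0}\partial_\lambda\langle A(x)\rangle_\lambda$, the first-order change of the expectation value of $A(x)$ in the ground state of the perturbed Hamiltonian $H+\lambda B(y)$. The time derivative of an operator $C$ is $\partial_t C=i[H,C]$. Time-reversal symmetric means that there is an antiunitary operator $T$ with $THT^{-1}=H$; operators $A$ and $B$ have the same $T$-charge if $TAT^{-1}=sA$ and $TBT^{-1}=sB$ with the same sign $s\in\{+1,-1\}$. *)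

theory Defs
  imports Complex_Main "HOL-Library.FuncSet"
begin

text \<open>
  The state space is a complex inner product space on which all operators are everywhere defined.
  Completeness is not required: a Hilbert space with bounded operators (in particular every
  finite-dimensional one) is an instance, and for unbounded operators the type stands for a common
  dense domain that is invariant under all operators involved.  The inner product is linear in its
  second argument.
\<close>

class complex_inner = ab_group_add +
  fixes scaleC :: "complex \<Rightarrow> 'a \<Rightarrow> 'a"  (infixr "*\<^sub>C" 75)
    and cinner :: "'a \<Rightarrow> 'a \<Rightarrow> complex"
  assumes scaleC_add_right: "a *\<^sub>C (x + y) = a *\<^sub>C x + a *\<^sub>C y"
    and scaleC_add_left: "(a + b) *\<^sub>C x = a *\<^sub>C x + b *\<^sub>C x"
    and scaleC_scaleC: "a *\<^sub>C (b *\<^sub>C x) = (a * b) *\<^sub>C x"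
    and scaleC_one: "1 *\<^sub>C x = x"
    and cinner_commute: "cinner x y = cnj (cinner y x)"
    and cinner_add_right: "cinner x (y + z) = cinner x y + cinner x z"
    and cinner_scaleC_right: "cinner x (a *\<^sub>C y) = a * cinner x y"
    and cinner_ge_zero: "0 \<le> Re (cinner x x)"
    and cinner_eq_zero: "cinner x x = 0 \<Longrightarrow> x = 0"

lemma vector_space_scaleC: "vector_space (scaleC :: complex \<Rightarrow> 'a::complex_inner \<Rightarrow> 'a)"
  by unfold_locales
    (simp_all add: scaleC_add_right scaleC_add_left scaleC_scaleC scaleC_one)

type_synonym 'h operator = "'h \<Rightarrow> 'h"

abbreviation linear_op :: "'h::complex_inner operator \<Rightarrow> bool" where
  "linear_op \<equiv> Vector_Spaces.linear scaleC scaleC"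

definition hermitian :: "'h::complex_inner operator \<Rightarrow> bool" where
  "hermitian X \<longleftrightarrow> linear_op X \<and> (\<forall>\<phi> \<psi>. cinner (X \<phi>) \<psi> = cinner \<phi> (X \<psi>))"

definition commutator :: "'h::complex_inner operator \<Rightarrow> 'h operator \<Rightarrow> 'h operator" where
  "commutator X Y = (\<lambda>\<psi>. X (Y \<psi>) - Y (X \<psi>))"

definition time_derivative :: "'h::complex_inner operator \<Rightarrow> 'h operator \<Rightarrow> 'h operator" where
  "time_derivative H X = (\<lambda>\<psi>. \<i> *\<^sub>C commutator H X \<psi>)"

definition expectation :: "'h::complex_inner \<Rightarrow> 'h operator \<Rightarrow> complex" where
  "expectation vac X = cinner vac (X vac)"

definition projector :: "'h::complex_inner \<Rightarrow> 'h operator" where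
  "projector vac = (\<lambda>\<psi>. cinner vac \<psi> *\<^sub>C vac)"

definition nondegenerate_ground_state ::
    "'h::complex_inner operator \<Rightarrow> real \<Rightarrow> 'h \<Rightarrow> bool" where
  "nondegenerate_ground_state H E\<^sub>0 vac \<longleftrightarrow>
     cinner vac vac = 1 \<and>
     H vac = complex_of_real E\<^sub>0 *\<^sub>C vac \<and>
     (\<forall>\<psi>. E\<^sub>0 * Re (cinner \<psi> \<psi>) \<le> Re (cinner \<psi> (H \<psi>))) \<and>
     (\<forall>\<psi>. H \<psi> = complex_of_real E\<^sub>0 *\<^sub>C \<psi> \<longrightarrow> (\<exists>c. \<psi> = c *\<^sub>C vac))"

definition resolvent ::
    "'h::complex_inner operator \<Rightarrow> real \<Rightarrow> 'h \<Rightarrow> 'h operator \<Rightarrow> bool" where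
  "resolvent H E\<^sub>0 vac G \<longleftrightarrow>
     linear_op G \<and>
     (\<forall>\<psi>. complex_of_real E\<^sub>0 *\<^sub>C G \<psi> - H (G \<psi>) = \<psi> - projector vac \<psi>) \<and>
     (\<forall>\<psi>. projector vac (G \<psi>) = 0) \<and> (\<forall>\<psi>. G (projector vac \<psi>) = 0)"

definition causation ::
    "'h::complex_inner \<Rightarrow> 'h operator \<Rightarrow> 'h operator \<Rightarrow> 'h operator \<Rightarrow> complex" where
  "causation vac G A B = expectation vac (A \<circ> G \<circ> B)"

definition antiunitary :: "'h::complex_inner operator \<Rightarrow> bool" where
  "antiunitary T \<longleftrightarrow>
     bij T \<and>
     (\<forall>\<phi> \<psi>. T (\<phi> + \<psi>) = T \<phi> + T \<psi>) \<and>
     (\<forall>c \<psi>. T (c *\<^sub>C \<psi>) = cnj c *\<^sub>C T \<psi>) \<and>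
     (\<forall>\<phi> \<psi>. cinner (T \<phi>) (T \<psi>) = cnj (cinner \<phi> \<psi>))"

definition time_reversal :: "'h::complex_inner operator \<Rightarrow> 'h operator \<Rightarrow> bool" where
  "time_reversal H T \<longleftrightarrow> antiunitary T \<and> T \<circ> H \<circ> inv T = H"

definition same_T_charge ::
    "'h::complex_inner operator \<Rightarrow> 'h operator \<Rightarrow> 'h operator \<Rightarrow> bool" where
  "same_T_charge T A B \<longleftrightarrow>
     (\<exists>s \<in> {1, -1 :: complex}.
        T \<circ> A \<circ> inv T = (\<lambda>\<psi>. s *\<^sub>C A \<psi>) \<and> T \<circ> B \<circ> inv T = (\<lambda>\<psi>. s *\<^sub>C B \<psi>))"

text \<open>
  Many-body structure: the degrees of freedom sit on a finite set \<open>\<Lambda>\<close> of points, and \<open>D p\<close> labels an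
  orthonormal basis (of arbitrary cardinality) of the local Hilbert space at \<open>p\<close>.  The tensor product
  of the local spaces is described by its product basis \<open>e \<sigma>\<close>, indexed by the configurations \<open>\<sigma>\<close>.
\<close>

definition product_basis ::
    "'p set \<Rightarrow> ('p \<Rightarrow> 'd set) \<Rightarrow> (('p \<Rightarrow> 'd) \<Rightarrow> 'h::complex_inner) \<Rightarrow> bool" where
  "product_basis \<Lambda> D e \<longleftrightarrow>
     finite \<Lambda> \<and>
     (\<forall>\<sigma> \<in> PiE \<Lambda> D. \<forall>\<tau> \<in> PiE \<Lambda> D. cinner (e \<sigma>) (e \<tau>) = (if \<sigma> = \<tau> then 1 else 0)) \<and>
     (\<forall>\<psi>. \<forall>\<epsilon>>0. \<exists>\<phi> \<in> module.span scaleC (e ` PiE \<Lambda> D). Re (cinner (\<psi> - \<phi>) (\<psi> - \<phi>)) < \<epsilon>)"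

text \<open>
  \<open>X\<close> is supported on \<open>S\<close> if \<open>X = X\<^sub>S \<otimes> 1\<close> with \<open>X\<^sub>S\<close> acting on the sites in \<open>S\<close>; \<open>m\<close> below is
  the matrix of \<open>X\<^sub>S\<close>.
\<close>

definition supported_on ::
    "'p set \<Rightarrow> ('p \<Rightarrow> 'd set) \<Rightarrow> (('p \<Rightarrow> 'd) \<Rightarrow> 'h::complex_inner) \<Rightarrow>
     'h operator \<Rightarrow> 'p set \<Rightarrow> bool" where
  "supported_on \<Lambda> D e X S \<longleftrightarrow>
     (\<exists>m :: ('p \<Rightarrow> 'd) \<Rightarrow> ('p \<Rightarrow> 'd) \<Rightarrow> complex. \<forall>\<sigma> \<in> PiE \<Lambda> D. \<forall>\<tau> \<in> PiE \<Lambda> D.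
        cinner (e \<sigma>) (X (e \<tau>)) =
          (if \<forall>p \<in> \<Lambda> - S. \<sigma> p = \<tau> p then m (restrict \<sigma> S) (restrict \<tau> S) else 0))"

definition disjoint_support ::
    "'p set \<Rightarrow> ('p \<Rightarrow> 'd set) \<Rightarrow> (('p \<Rightarrow> 'd) \<Rightarrow> 'h::complex_inner) \<Rightarrow>
     'h operator \<Rightarrow> 'h operator \<Rightarrow> bool" where
  "disjoint_support \<Lambda> D e X Y \<longleftrightarrow>
     (\<exists>R S. supported_on \<Lambda> D e X R \<and> supported_on \<Lambda> D e Y S \<and> R \<inter> S = {})"

text \<open>
  \<open>r\<close> is the range of an operator located at \<open>x\<close>; as \<open>\<Lambda>\<close> is finite, every operator is located at
  \<open>x\<close> for some \<open>r\<close>.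
\<close>

definition located_at ::
    "'p::metric_space set \<Rightarrow> ('p \<Rightarrow> 'd set) \<Rightarrow> (('p \<Rightarrow> 'd) \<Rightarrow> 'h::complex_inner) \<Rightarrow>
     'h operator \<Rightarrow> 'p \<Rightarrow> real \<Rightarrow> bool" where
  "located_at \<Lambda> D e X x r \<longleftrightarrow> supported_on \<Lambda> D e X {p. dist x p \<le> r}"

end

theory Submission
  imports Defs
begin

text \<open>
  Since \<open>vac\<close> is an eigenvector of \<open>H\<close>, \<open>\<langle>[H, C] G B\<rangle> = \<langle>C (E\<^sub>0 - H) G B\<rangle> = \<langle>C B\<rangle> - \<langle>C\<rangle> \<langle>B\<rangle>\<close>, so the
  causation function is \<open>\<kappa> \<i> \<langle>C B\<rangle>\<close>, and adding the conjugate produces the commutator.  Operators with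
  disjoint supports commute even when unbounded: in the expansion of \<open>\<langle>e \<sigma>, C B (e \<tau>)\<rangle>\<close> over the
  product basis at most one intermediate configuration contributes.  Time reversal commutes with \<open>G\<close>
  and fixes \<open>vac\<close> up to a phase, so equal charges make the causation function real, while its real
  part vanishes.
\<close>

section \<open>Geometry of complex inner product spaces\<close>

interpretation complex_space: vector_space "scaleC :: complex \<Rightarrow> 'a \<Rightarrow> 'a::complex_inner"
  by (rule vector_space_scaleC)

lemma cinner_add_left: "cinner (x + y) z = cinner x z + cinner y z"
  by (metis cinner_add_right cinner_commute complex_cnj_add)

lemma cinner_scaleC_left: "cinner (a *\<^sub>C x) y = cnj a * cinner x y"
  by (metis cinner_commute cinner_scaleC_right complex_cnj_mult)

lemma cinner_zero_right [simp]: "cinner x 0 = 0"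
  using cinner_add_right[of x 0 0] by simp

lemma cinner_zero_left [simp]: "cinner 0 x = 0"
  using cinner_add_left[of 0 0 x] by simp

lemma cinner_diff_right: "cinner x (y - z) = cinner x y - cinner x z"
  using cinner_add_right[of x "y - z" z] by simp

lemma cinner_diff_left: "cinner (x - y) z = cinner x z - cinner y z"
  using cinner_add_left[of "x - y" y z] by simp

lemma cinner_self_real: "cinner x x = complex_of_real (Re (cinner x x))"
proof -
  have "Im (cinner x x) = - Im (cinner x x)"
    using arg_cong[OF cinner_commute[of x x], of Im] by simp
  then show ?thesis
    by (simp add: complex_eq_iff)
qed

lemma cinner_eq_zero_commute: "cinner x y = 0 \<longleftrightarrow> cinner y x = 0"
  by (metis cinner_commute complex_cnj_zero)

lemma cinner_Cauchy_Schwarz: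
  "(cmod (cinner x y))\<^sup>2 \<le> Re (cinner x x) * Re (cinner y y)"
proof (cases "y = 0")
  case False
  define n where "n = Re (cinner y y)"
  have yy: "cinner y y = complex_of_real n"
    unfolding n_def by (rule cinner_self_real)
  have "n > 0"
    using cinner_ge_zero[of y] cinner_eq_zero[of y] False yy unfolding n_def
    by (metis less_eq_real_def of_real_0)
  \<comment> \<open>\<open>a *\<^sub>C y\<close> is the orthogonal projection of \<open>x\<close>
    onto the line through \<open>y\<close>. Nonnegativity of the squared norm of the remainder,
    multiplied by \<open>n\<close>, is the inequality.\<close>
  define a where "a = cinner y x / complex_of_real n"
  have yx: "cinner y x = a * complex_of_real n"
    using \<open>n > 0\<close> by (simp add: a_def)
  have xy: "cinner x y = cnj a * complex_of_real n"
    using cinner_commute[of x y] yx by simp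
  have "cinner (x - a *\<^sub>C y) (x - a *\<^sub>C y) = cinner x x - a * cnj a * complex_of_real n"
    by (simp add: cinner_diff_left cinner_diff_right cinner_scaleC_left cinner_scaleC_right yy yx xy)
  also have "\<dots> = cinner x x - complex_of_real ((cmod a)\<^sup>2 * n)"
    using complex_norm_square[of a] by simp
  finally have "0 \<le> Re (cinner x x) - (cmod a)\<^sup>2 * n"
    using cinner_ge_zero[of "x - a *\<^sub>C y"] by simp
  then have "(cmod a)\<^sup>2 * n * n \<le> Re (cinner x x) * n"
    using \<open>n > 0\<close> by (intro mult_right_mono) auto
  then show ?thesis
    using \<open>n > 0\<close> by (simp add: xy n_def[symmetric] norm_mult power_mult_distrib power2_eq_square ac_simps)
qed simp

lemma cinner_span_eq_zero:
  assumes "\<psi> \<in> module.span scaleC S" and "\<And>v. v \<in> S \<Longrightarrow> cinner \<phi> v = 0"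
  shows "cinner \<phi> \<psi> = 0"
  using assms(1)
proof (induction rule: complex_space.span_induct_alt)
  case base
  show ?case by simp
next
  case (step c v w)
  then show ?case
    by (simp add: cinner_add_right cinner_scaleC_right assms(2))
qed

lemma linear_op_diff: "linear_op X \<Longrightarrow> X (u - v) = X u - X v"
  by (rule module_hom.diff[OF Vector_Spaces.linear.axioms(3)])

lemma linear_op_scaleC: "linear_op X \<Longrightarrow> X (c *\<^sub>C v) = c *\<^sub>C X v"
  by (rule module_hom.scale[OF Vector_Spaces.linear.axioms(3)])

lemma hermitian_linear: "hermitian X \<Longrightarrow> linear_op X"
  by (simp add: hermitian_def)

lemma hermitian_cinner: "hermitian X \<Longrightarrow> cinner (X \<phi>) \<psi> = cinner \<phi> (X \<psi>)"
  by (simp add: hermitian_def)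

subsection \<open>Product bases and disjoint supports\<close>

text \<open>The instance of Parseval's identity in which all terms of the expansion vanish.\<close>

lemma product_basis_cinner_eq_zero:
  fixes e :: "('p \<Rightarrow> 'd) \<Rightarrow> 'h::complex_inner"
  assumes basis: "product_basis \<Lambda> D e"
    and terms: "\<And>\<rho>. \<rho> \<in> PiE \<Lambda> D \<Longrightarrow> cinner \<phi> (e \<rho>) = 0 \<or> cinner (e \<rho>) \<psi> = 0"
  shows "cinner \<phi> \<psi> = 0"
proof (rule ccontr)
  assume nz: "cinner \<phi> \<psi> \<noteq> 0"
  \<comment> \<open>The basis is split into the vectors orthogonal to \<open>\<phi>\<close> and the
    others, which are orthogonal to \<open>\<psi>\<close> by \<open>terms\<close>. An approximation
    of \<open>\<psi>\<close> then splits into mutually orthogonal parts \<open>u\<close> and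
    \<open>v\<close> with \<open>u\<close> orthogonal to \<open>\<phi>\<close> and \<open>v\<close>
    orthogonal to \<open>\<psi>\<close>.\<close>
  define S1 where "S1 = e ` {\<rho> \<in> PiE \<Lambda> D. cinner \<phi> (e \<rho>) = 0}"
  define S2 where "S2 = e ` {\<rho> \<in> PiE \<Lambda> D. cinner \<phi> (e \<rho>) \<noteq> 0}"
  define N where "N = Re (cinner \<phi> \<phi>)"
  \<comment> \<open>Chosen so that \<open>N * \<epsilon>\<close> lies strictly below the squared
    modulus of the inner product; \<open>N + 1\<close> keeps the denominator positive when
    \<open>N\<close> is zero.\<close>
  define \<epsilon> where "\<epsilon> = (cmod (cinner \<phi> \<psi>))\<^sup>2 / (N + 1)"
  have "N \<ge> 0"
    unfolding N_def by (rule cinner_ge_zero)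
  have "\<epsilon> > 0"
    using nz \<open>N \<ge> 0\<close> by (simp add: \<epsilon>_def)
  then obtain \<chi> where \<chi>: "\<chi> \<in> module.span scaleC (e ` PiE \<Lambda> D)"
      and close: "Re (cinner (\<psi> - \<chi>) (\<psi> - \<chi>)) < \<epsilon>"
    using basis unfolding product_basis_def by blast
  have "e ` PiE \<Lambda> D = S1 \<union> S2"
    unfolding S1_def S2_def by auto
  then obtain u v where u: "u \<in> module.span scaleC S1" and v: "v \<in> module.span scaleC S2"
      and \<chi>_eq: "\<chi> = u + v"
    using \<chi> by (auto simp: complex_space.span_Un)
  have \<phi>u: "cinner \<phi> u = 0"
    using u by (rule cinner_span_eq_zero) (auto simp: S1_def)
  have "cinner \<psi> v = 0"
    using v by (rule cinner_span_eq_zero) (use terms cinner_eq_zero_commute in \<open>auto simp: S2_def\<close>)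
  moreover have "cinner u v = 0"
    using v
  proof (rule cinner_span_eq_zero)
    fix w assume "w \<in> S2"
    then have "cinner w u = 0"
      using basis u unfolding S1_def S2_def product_basis_def
      by (intro cinner_span_eq_zero[OF u]) (auto simp: S1_def)
    then show "cinner u w = 0"
      by (simp add: cinner_eq_zero_commute)
  qed
  ultimately have orth: "cinner (\<psi> - u) v = 0" "cinner v (\<psi> - u) = 0"
    by (simp_all add: cinner_diff_left cinner_eq_zero_commute[of v])
  \<comment> \<open>By Pythagoras, dropping \<open>v\<close> does not worsen the approximation, so
    \<open>u\<close> alone is close to \<open>\<psi>\<close> although it is orthogonal to
    \<open>\<phi>\<close>.\<close>
  have "cinner (\<psi> - \<chi>) (\<psi> - \<chi>) = cinner ((\<psi> - u) - v) ((\<psi> - u) - v)"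
    by (simp add: \<chi>_eq algebra_simps)
  also have "\<dots> = cinner (\<psi> - u) (\<psi> - u) + cinner v v"
    unfolding cinner_diff_left[of "\<psi> - u" v] cinner_diff_right[of _ "\<psi> - u" v] using orth by simp
  finally have near: "Re (cinner (\<psi> - u) (\<psi> - u)) < \<epsilon>"
    using close cinner_ge_zero[of v] by simp
  have "(cmod (cinner \<phi> \<psi>))\<^sup>2 = (cmod (cinner \<phi> (\<psi> - u)))\<^sup>2"
    by (simp add: cinner_diff_right \<phi>u)
  also have "\<dots> \<le> N * Re (cinner (\<psi> - u) (\<psi> - u))"
    unfolding N_def by (rule cinner_Cauchy_Schwarz)
  also have "\<dots> \<le> N * \<epsilon>"
    using near \<open>N \<ge> 0\<close> by (intro mult_left_mono) auto
  also have "\<dots> < (N + 1) * \<epsilon>"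
    using \<open>\<epsilon> > 0\<close> by simp
  also have "\<dots> = (cmod (cinner \<phi> \<psi>))\<^sup>2"
    using \<open>N \<ge> 0\<close> by (simp add: \<epsilon>_def)
  finally show False by simp
qed

text \<open>A vector orthogonal to the whole basis is orthogonal to itself, by the preceding lemma
  with both arguments equal.\<close>

lemma product_basis_separating:
  assumes "product_basis \<Lambda> D e" and "\<And>\<rho>. \<rho> \<in> PiE \<Lambda> D \<Longrightarrow> cinner (e \<rho>) \<psi> = 0"
  shows "\<psi> = 0"
  using product_basis_cinner_eq_zero[of \<Lambda> D e \<psi> \<psi>] assms cinner_eq_zero by blast

text \<open>Subtracting from \<open>\<phi>\<close> its component along \<open>e \<rho>0\<close>
  makes every term of the expansion vanish.\<close>

lemma product_basis_cinner_single:
  assumes basis: "product_basis \<Lambda> D e" and \<rho>0: "\<rho>0 \<in> PiE \<Lambda> D"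
    and terms: "\<And>\<rho>. \<rho> \<in> PiE \<Lambda> D \<Longrightarrow> \<rho> \<noteq> \<rho>0 \<Longrightarrow> cinner \<phi> (e \<rho>) = 0 \<or> cinner (e \<rho>) \<psi> = 0"
  shows "cinner \<phi> \<psi> = cinner \<phi> (e \<rho>0) * cinner (e \<rho>0) \<psi>"
proof -
  have orth: "cinner (e \<rho>0) (e \<rho>) = (if \<rho>0 = \<rho> then 1 else 0)" if "\<rho> \<in> PiE \<Lambda> D" for \<rho>
    using basis \<rho>0 that unfolding product_basis_def by blast
  have "cinner (\<phi> - cinner (e \<rho>0) \<phi> *\<^sub>C e \<rho>0) \<psi> = 0"
  proof (rule product_basis_cinner_eq_zero[OF basis])
    fix \<rho> assume "\<rho> \<in> PiE \<Lambda> D"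
    then show "cinner (\<phi> - cinner (e \<rho>0) \<phi> *\<^sub>C e \<rho>0) (e \<rho>) = 0 \<or> cinner (e \<rho>) \<psi> = 0"
      using terms[of \<rho>] orth[of \<rho>] cinner_commute[of \<phi> "e \<rho>0"]
      by (cases "\<rho> = \<rho>0") (auto simp: cinner_diff_left cinner_scaleC_left)
  qed
  then show ?thesis
    using cinner_commute[of \<phi> "e \<rho>0"] by (simp add: cinner_diff_left cinner_scaleC_left)
qed

section \<open>Matrix elements of operators with disjoint supports\<close>

text \<open>Exposes the witness hidden in \<open>supported_on\<close>, so that the same two matrices
  serve for both orders of a product.\<close>

definition support_matrix ::
    "'p set \<Rightarrow> ('p \<Rightarrow> 'd set) \<Rightarrow> (('p \<Rightarrow> 'd) \<Rightarrow> 'h::complex_inner) \<Rightarrow>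
     'h operator \<Rightarrow> 'p set \<Rightarrow> (('p \<Rightarrow> 'd) \<Rightarrow> ('p \<Rightarrow> 'd) \<Rightarrow> complex) \<Rightarrow> bool" where
  "support_matrix \<Lambda> D e X S m \<longleftrightarrow>
     (\<forall>\<sigma> \<in> PiE \<Lambda> D. \<forall>\<tau> \<in> PiE \<Lambda> D. cinner (e \<sigma>) (X (e \<tau>)) =
        (if \<forall>p \<in> \<Lambda> - S. \<sigma> p = \<tau> p then m (restrict \<sigma> S) (restrict \<tau> S) else 0))"

lemma support_matrixD:
  assumes "support_matrix \<Lambda> D e X S m" and "\<sigma> \<in> PiE \<Lambda> D" and "\<tau> \<in> PiE \<Lambda> D"
  shows "cinner (e \<sigma>) (X (e \<tau>)) =
    (if \<forall>p \<in> \<Lambda> - S. \<sigma> p = \<tau> p then m (restrict \<sigma> S) (restrict \<tau> S) else 0)"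
  using assms unfolding support_matrix_def by (elim ballE) auto

lemma supported_on_iff_support_matrix:
  "supported_on \<Lambda> D e X S \<longleftrightarrow> (\<exists>m. support_matrix \<Lambda> D e X S m)"
  unfolding supported_on_def support_matrix_def ..

text \<open>Hermiticity moves \<open>X\<close> to the left, so that the product becomes an inner
  product to be expanded in the basis, where only one term survives. The resulting formula is
  symmetric under exchanging the two operators, which yields commutation.\<close>

lemma support_matrix_product:
  fixes X Y :: "'h::complex_inner operator"
  assumes basis: "product_basis \<Lambda> D e" and X: "hermitian X"
    and mX: "support_matrix \<Lambda> D e X R mX" and mY: "support_matrix \<Lambda> D e Y S mY"
    and disj: "R \<inter> S = {}"
    and \<sigma>: "\<sigma> \<in> PiE \<Lambda> D" and \<tau>: "\<tau> \<in> PiE \<Lambda> D"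
  shows "cinner (e \<sigma>) (X (Y (e \<tau>))) =
    (if \<forall>p \<in> \<Lambda> - R - S. \<sigma> p = \<tau> p
     then mX (restrict \<sigma> R) (restrict \<tau> R) * mY (restrict \<sigma> S) (restrict \<tau> S) else 0)"
proof -
  \<comment> \<open>A nonzero factor from \<open>X\<close> forces the intermediate configuration to
    equal \<open>\<sigma>\<close> off \<open>R\<close>, one from \<open>Y\<close> forces it to equal
    \<open>\<tau>\<close> off \<open>S\<close>, hence on \<open>R\<close>. Only
    \<open>\<rho>0\<close> meets both demands.\<close>
  define \<rho>0 where "\<rho>0 = (\<lambda>p. if p \<in> R then \<tau> p else \<sigma> p)"
  have \<rho>0: "\<rho>0 \<in> PiE \<Lambda> D"
    using \<sigma> \<tau> unfolding \<rho>0_def by (auto simp: PiE_iff extensional_def)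
  have Xe: "cinner (X (e \<sigma>)) (e \<rho>) = cinner (e \<sigma>) (X (e \<rho>))" for \<rho>
    using X by (rule hermitian_cinner)
  have unique: "\<rho> = \<rho>0" if \<rho>: "\<rho> \<in> PiE \<Lambda> D"
      and 1: "\<forall>p \<in> \<Lambda> - R. \<sigma> p = \<rho> p" and 2: "\<forall>p \<in> \<Lambda> - S. \<rho> p = \<tau> p" for \<rho>
  proof (rule PiE_ext[OF \<rho> \<rho>0])
    fix p assume "p \<in> \<Lambda>"
    then show "\<rho> p = \<rho>0 p"
      using 1 2 disj unfolding \<rho>0_def by auto
  qed
  have "cinner (e \<sigma>) (X (Y (e \<tau>))) = cinner (X (e \<sigma>)) (Y (e \<tau>))"
    by (simp add: hermitian_cinner[OF X])
  also have "\<dots> = cinner (X (e \<sigma>)) (e \<rho>0) * cinner (e \<rho>0) (Y (e \<tau>))"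
  proof (rule product_basis_cinner_single[OF basis \<rho>0])
    fix \<rho> assume \<rho>: "\<rho> \<in> PiE \<Lambda> D" and "\<rho> \<noteq> \<rho>0"
    then show "cinner (X (e \<sigma>)) (e \<rho>) = 0 \<or> cinner (e \<rho>) (Y (e \<tau>)) = 0"
      using unique[OF \<rho>] support_matrixD[OF mX \<sigma> \<rho>] support_matrixD[OF mY \<rho> \<tau>] unfolding Xe by presburger
  qed
  also have "cinner (X (e \<sigma>)) (e \<rho>0) = mX (restrict \<sigma> R) (restrict \<tau> R)"
  proof -
    have "restrict \<rho>0 R = restrict \<tau> R" and "\<forall>p \<in> \<Lambda> - R. \<sigma> p = \<rho>0 p"
      by (auto simp: \<rho>0_def)
    then show ?thesis
      using support_matrixD[OF mX \<sigma> \<rho>0] unfolding Xe by simp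
  qed
  also have "cinner (e \<rho>0) (Y (e \<tau>)) =
      (if \<forall>p \<in> \<Lambda> - R - S. \<sigma> p = \<tau> p then mY (restrict \<sigma> S) (restrict \<tau> S) else 0)"
  proof -
    have "restrict \<rho>0 S = restrict \<sigma> S"
      using disj unfolding \<rho>0_def by (intro restrict_ext) auto
    moreover have "(\<forall>p \<in> \<Lambda> - S. \<rho>0 p = \<tau> p) \<longleftrightarrow> (\<forall>p \<in> \<Lambda> - R - S. \<sigma> p = \<tau> p)"
      by (auto simp: \<rho>0_def)
    ultimately show ?thesis
      using support_matrixD[OF mY \<rho>0 \<tau>] by simp
  qed
  finally show ?thesis
    by (simp only: mult_zero_right if_distrib[of "(*) _"])
qed

lemma disjoint_support_commute:
  fixes X Y :: "'h::complex_inner operator"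
  assumes basis: "product_basis \<Lambda> D e" and X: "hermitian X" and Y: "hermitian Y"
    and disj: "disjoint_support \<Lambda> D e X Y"
  shows "commutator X Y = (\<lambda>_. 0)"
proof -
  obtain R S where X_R: "supported_on \<Lambda> D e X R" and Y_S: "supported_on \<Lambda> D e Y S"
    and RS: "R \<inter> S = {}"
    using disj unfolding disjoint_support_def by blast
  obtain mX where mX: "support_matrix \<Lambda> D e X R mX"
    using X_R unfolding supported_on_iff_support_matrix ..
  obtain mY where mY: "support_matrix \<Lambda> D e Y S mY"
    using Y_S unfolding supported_on_iff_support_matrix ..
  have SR: "S \<inter> R = {}"
    using RS by blast
  have comm_e: "X (Y (e \<tau>)) - Y (X (e \<tau>)) = 0" if \<tau>: "\<tau> \<in> PiE \<Lambda> D" for \<tau>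
  proof (rule product_basis_separating[OF basis])
    fix \<sigma> assume \<sigma>: "\<sigma> \<in> PiE \<Lambda> D"
    have "\<Lambda> - S - R = \<Lambda> - R - S"
      by blast
    then show "cinner (e \<sigma>) (X (Y (e \<tau>)) - Y (X (e \<tau>))) = 0"
      using support_matrix_product[OF basis X mX mY RS \<sigma> \<tau>]
        support_matrix_product[OF basis Y mY mX SR \<sigma> \<tau>]
      by (simp add: cinner_diff_right)
  qed
  \<comment> \<open>For unbounded operators density of the span does not carry the identity from
    basis vectors to \<open>\<psi>\<close>. Instead hermiticity shifts the commutator onto the basis
    vector \<open>e \<sigma>\<close>.\<close>
  have "X (Y \<psi>) - Y (X \<psi>) = 0" for \<psi>
  proof (rule product_basis_separating[OF basis])
    fix \<sigma> assume \<sigma>: "\<sigma> \<in> PiE \<Lambda> D"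
    have "cinner (e \<sigma>) (X (Y \<psi>) - Y (X \<psi>)) = cinner (Y (X (e \<sigma>)) - X (Y (e \<sigma>))) \<psi>"
      by (simp add: cinner_diff_left cinner_diff_right hermitian_cinner[OF X] hermitian_cinner[OF Y])
    then show "cinner (e \<sigma>) (X (Y \<psi>) - Y (X \<psi>)) = 0"
      using comm_e[OF \<sigma>] by simp
  qed
  then show ?thesis
    unfolding commutator_def by simp
qed

lemma located_at_disjoint_support:
  assumes "located_at \<Lambda> D e X x r" and "located_at \<Lambda> D e Y y s" and "dist x y > s + r"
  shows "disjoint_support \<Lambda> D e X Y"
proof -
  have "{p. dist x p \<le> r} \<inter> {p. dist y p \<le> s} = {}"
  proof (safe, simp)
    fix p assume "dist x p \<le> r" and "dist y p \<le> s"
    then show False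
      using dist_triangle2[of x y p] assms(3) by simp
  qed
  then show ?thesis
    using assms(1,2) unfolding located_at_def disjoint_support_def by blast
qed

subsection \<open>The causation function\<close>

text \<open>Fixes the component along \<open>vac\<close>, which the equation for
  \<open>(E - H) G\<close> leaves undetermined.\<close>

lemma resolvent_orthogonal:
  assumes "nondegenerate_ground_state H E vac" and "resolvent H E vac G"
  shows "cinner vac (G \<psi>) = 0"
proof -
  have "cinner vac (projector vac (G \<psi>)) = 0"
    using assms(2) by (simp add: resolvent_def)
  then show ?thesis
    using assms(1) by (simp add: projector_def cinner_scaleC_right nondegenerate_ground_state_def)
qed

lemma causation_time_derivative:
  assumes H: "hermitian H" and gs: "nondegenerate_ground_state H E vac"
    and res: "resolvent H E vac G" and C: "hermitian C" and B0: "expectation vac B = 0"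
  shows "causation vac G (\<lambda>\<psi>. complex_of_real \<kappa> *\<^sub>C time_derivative H C \<psi>) B
    = complex_of_real \<kappa> * \<i> * expectation vac (C \<circ> B)"
proof -
  define \<phi> where "\<phi> = G (B vac)"
  have Hvac: "H vac = complex_of_real E *\<^sub>C vac"
    using gs by (simp add: nondegenerate_ground_state_def)
  \<comment> \<open>The projector term of the resolvent equation drops out because \<open>B\<close>
    has vanishing expectation value.\<close>
  have res_\<phi>: "complex_of_real E *\<^sub>C \<phi> - H \<phi> = B vac"
    using res B0 unfolding resolvent_def \<phi>_def by (simp add: projector_def expectation_def)
  \<comment> \<open>\<open>H\<close> acts to the left on its eigenvector, which turns the commutator
    into \<open>C\<close> applied to \<open>(E - H) \<phi>\<close>.\<close>
  have "cinner vac (H (C \<phi>)) = complex_of_real E * cinner vac (C \<phi>)"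
    using hermitian_cinner[OF H, of vac "C \<phi>"] by (simp add: Hvac cinner_scaleC_left)
  then have "cinner vac (commutator H C \<phi>) = cinner vac (C (complex_of_real E *\<^sub>C \<phi> - H \<phi>))"
    by (simp add: commutator_def cinner_diff_right cinner_scaleC_right
        linear_op_diff linear_op_scaleC hermitian_linear[OF C])
  then show ?thesis
    by (simp add: causation_def expectation_def time_derivative_def cinner_scaleC_right
        res_\<phi> flip: \<phi>_def)
qed

lemma expectation_hermitian_comp_commute:
  assumes "hermitian X" and "hermitian Y"
  shows "cnj (expectation vac (X \<circ> Y)) = expectation vac (Y \<circ> X)"
  using cinner_commute[of vac "Y (X vac)"]
  by (simp add: expectation_def hermitian_cinner[OF assms(1)] hermitian_cinner[OF assms(2)])

subsection \<open>Time reversal\<close>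

lemma conjugate_eqD:
  assumes "bij T" and "T \<circ> X \<circ> inv T = Y"
  shows "T (X \<psi>) = Y (T \<psi>)"
  using assms by (auto simp: bij_is_inj)

lemma time_reversal_commute: "time_reversal H T \<Longrightarrow> T (H \<psi>) = H (T \<psi>)"
  using conjugate_eqD[of T H H] by (simp add: time_reversal_def antiunitary_def)

lemma antiunitary_scaleC: "antiunitary T \<Longrightarrow> T (c *\<^sub>C \<psi>) = cnj c *\<^sub>C T \<psi>"
  by (simp add: antiunitary_def)

lemma antiunitary_cinner: "antiunitary T \<Longrightarrow> cinner (T \<phi>) (T \<psi>) = cnj (cinner \<phi> \<psi>)"
  by (simp add: antiunitary_def)

lemma antiunitary_diff:
  assumes "antiunitary T"
  shows "T (\<phi> - \<psi>) = T \<phi> - T \<psi>"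
proof -
  have "T ((\<phi> - \<psi>) + \<psi>) = T (\<phi> - \<psi>) + T \<psi>"
    using assms unfolding antiunitary_def by blast
  then show ?thesis
    by (simp add: algebra_simps)
qed

text \<open>Since \<open>E\<close> is real, conjugation by \<open>T\<close> leaves it unchanged, so
  \<open>T vac\<close> is again an eigenvector for \<open>E\<close> and nondegeneracy applies.
  Preservation of the norm makes \<open>c\<close> a phase.\<close>

lemma time_reversal_ground_state:
  assumes gs: "nondegenerate_ground_state H E vac" and T: "time_reversal H T"
  obtains c where "T vac = c *\<^sub>C vac" and "cnj c * c = 1"
proof -
  have au: "antiunitary T"
    using T by (simp add: time_reversal_def)
  have vac: "cinner vac vac = 1" "H vac = complex_of_real E *\<^sub>C vac"
    using gs by (simp_all add: nondegenerate_ground_state_def)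
  have "H (T vac) = complex_of_real E *\<^sub>C T vac"
    using time_reversal_commute[OF T, of vac] by (simp add: vac antiunitary_scaleC[OF au])
  then obtain c where c: "T vac = c *\<^sub>C vac"
    using gs unfolding nondegenerate_ground_state_def by blast
  moreover have "cnj c * c = 1"
    using antiunitary_cinner[OF au, of vac vac]
    by (simp add: c vac cinner_scaleC_left cinner_scaleC_right ac_simps)
  ultimately show ?thesis ..
qed

text \<open>Both sides solve the same resolvent equation, so their difference is an eigenvector for
  \<open>E\<close> and hence a multiple of \<open>vac\<close>. Both are orthogonal to
  \<open>vac\<close>, so the multiple is zero.\<close>

lemma time_reversal_resolvent:
  assumes H: "hermitian H" and gs: "nondegenerate_ground_state H E vac"
    and res: "resolvent H E vac G" and T: "time_reversal H T"
  shows "T (G \<psi>) = G (T \<psi>)"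
proof -
  have au: "antiunitary T"
    using T by (simp add: time_reversal_def)
  obtain c where c: "T vac = c *\<^sub>C vac" and cc: "cnj c * c = 1"
    using time_reversal_ground_state[OF gs T] .
  have c0: "c \<noteq> 0"
    using cc by auto
  have vac: "cinner vac vac = 1"
    using gs by (simp add: nondegenerate_ground_state_def)
  have res': "complex_of_real E *\<^sub>C G \<phi> - H (G \<phi>) = \<phi> - projector vac \<phi>" for \<phi>
    using res by (simp add: resolvent_def)
  have overlap: "cnj (cinner vac \<phi>) = cnj c * cinner vac (T \<phi>)" for \<phi>
    using antiunitary_cinner[OF au, of vac \<phi>] by (simp add: c cinner_scaleC_left)
  \<comment> \<open>The phase picked up by \<open>vac\<close> as a vector cancels the conjugate
    phase in the overlap.\<close>
  have proj: "T (projector vac \<phi>) = projector vac (T \<phi>)" for \<phi>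
  proof -
    have "cnj (cinner vac \<phi>) * c = (cnj c * c) * cinner vac (T \<phi>)"
      unfolding overlap by simp
    then show ?thesis
      by (simp add: projector_def antiunitary_scaleC[OF au] c scaleC_scaleC cc)
  qed
  define \<chi> where "\<chi> = T (G \<psi>) - G (T \<psi>)"
  have "complex_of_real E *\<^sub>C T (G \<psi>) - H (T (G \<psi>)) = T (complex_of_real E *\<^sub>C G \<psi> - H (G \<psi>))"
    by (simp add: antiunitary_diff[OF au] antiunitary_scaleC[OF au] time_reversal_commute[OF T])
  also have "\<dots> = T \<psi> - projector vac (T \<psi>)"
    unfolding res' by (simp add: antiunitary_diff[OF au] proj)
  also have "\<dots> = complex_of_real E *\<^sub>C G (T \<psi>) - H (G (T \<psi>))"
    by (rule res'[symmetric])
  finally have "H \<chi> = complex_of_real E *\<^sub>C \<chi>"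
    by (simp add: \<chi>_def linear_op_diff[OF hermitian_linear[OF H]]
        complex_space.scale_right_diff_distrib algebra_simps)
  then obtain d where d: "\<chi> = d *\<^sub>C vac"
    using gs unfolding nondegenerate_ground_state_def by blast
  have "cinner vac (T (G \<psi>)) = 0"
    using overlap[of "G \<psi>"] resolvent_orthogonal[OF gs res, of \<psi>] c0 by simp
  then have "cinner vac \<chi> = 0"
    by (simp add: \<chi>_def cinner_diff_right resolvent_orthogonal[OF gs res])
  then have "d = 0"
    by (simp add: d cinner_scaleC_right vac)
  then show ?thesis
    using d by (simp add: \<chi>_def)
qed

text \<open>Applying \<open>T\<close> to both arguments of the inner product conjugates it. The
  phase of \<open>T vac\<close> enters both arguments and cancels, and the two equal signs multiply
  to one.\<close>

lemma causation_real:
  assumes H: "hermitian H" and gs: "nondegenerate_ground_state H E vac"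
    and res: "resolvent H E vac G" and A: "linear_op A" and B: "linear_op B"
    and T: "time_reversal H T" and charge: "same_T_charge T A B"
  shows "cnj (causation vac G A B) = causation vac G A B"
proof -
  have au: "antiunitary T" and bij: "bij T"
    using T by (simp_all add: time_reversal_def antiunitary_def)
  have G: "linear_op G"
    using res by (simp add: resolvent_def)
  obtain s where s: "s = 1 \<or> s = -1"
    and TA: "T \<circ> A \<circ> inv T = (\<lambda>\<psi>. s *\<^sub>C A \<psi>)" and TB: "T \<circ> B \<circ> inv T = (\<lambda>\<psi>. s *\<^sub>C B \<psi>)"
    using charge unfolding same_T_charge_def by blast
  have ss: "s * s = 1"
    using s by auto
  obtain c where c: "T vac = c *\<^sub>C vac" and cc: "cnj c * c = 1"
    using time_reversal_ground_state[OF gs T] .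
  have "T (A (G (B vac))) = s *\<^sub>C A (G (s *\<^sub>C B (T vac)))"
    by (simp add: conjugate_eqD[OF bij TA] conjugate_eqD[OF bij TB] time_reversal_resolvent[OF H gs res T])
  also have "\<dots> = (s * s * c) *\<^sub>C A (G (B vac))"
    by (simp add: c linear_op_scaleC A B G scaleC_scaleC)
  finally have "T (A (G (B vac))) = c *\<^sub>C A (G (B vac))"
    by (simp add: ss)
  then have "cnj (cinner vac (A (G (B vac)))) = cnj c * (c * cinner vac (A (G (B vac))))"
    using antiunitary_cinner[OF au, of vac "A (G (B vac))"]
    by (simp add: c cinner_scaleC_left cinner_scaleC_right ac_simps)
  also have "\<dots> = cinner vac (A (G (B vac)))"
    using cc by (simp flip: mult.assoc)
  finally show ?thesis
    by (simp add: causation_def expectation_def)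
qed

theorem mainTheorem1:
  fixes \<Lambda> :: "'p::metric_space set"
    and D :: "'p \<Rightarrow> 'd set"
    and e :: "('p \<Rightarrow> 'd) \<Rightarrow> 'h::complex_inner"
    and H G A B C :: "'h operator"
    and E\<^sub>0 \<kappa> r\<^sub>A r\<^sub>B r\<^sub>C :: real
    and vac :: 'h
    and x y :: 'p
  assumes "product_basis \<Lambda> D e"
    and "hermitian H"
    and "nondegenerate_ground_state H E\<^sub>0 vac"
    and "resolvent H E\<^sub>0 vac G"
    and "hermitian A" and "hermitian B" and "hermitian C"
    and "located_at \<Lambda> D e A x r\<^sub>A"
    and "located_at \<Lambda> D e B y r\<^sub>B"
    and "located_at \<Lambda> D e C x r\<^sub>C"
    and "expectation vac A = 0" and "expectation vac B = 0" and "expectation vac C = 0"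
    and "A = (\<lambda>\<psi>. complex_of_real \<kappa> *\<^sub>C time_derivative H C \<psi>)"
  shows
    "causation vac G A B + cnj (causation vac G A B)
       = complex_of_real \<kappa> * \<i> * expectation vac (commutator C B)
     \<and> (commutator C B = (\<lambda>_. 0) \<longrightarrow>
          causation vac G A B + cnj (causation vac G A B) = 0)
     \<and> (disjoint_support \<Lambda> D e C B \<longrightarrow> commutator C B = (\<lambda>_. 0))
     \<and> (dist x y > r\<^sub>B + r\<^sub>C \<longrightarrow> disjoint_support \<Lambda> D e C B)
     \<and> (commutator C B = (\<lambda>_. 0) \<longrightarrow>
          (\<forall>T. time_reversal H T \<and> same_T_charge T A B \<longrightarrow> causation vac G A B = 0))"
proof -
  note basis = assms(1) and H = assms(2) and gs = assms(3) and res = assms(4)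
    and A = assms(5) and B = assms(6) and C = assms(7)
  have "causation vac G A B = complex_of_real \<kappa> * \<i> * expectation vac (C \<circ> B)"
    unfolding assms(14) by (rule causation_time_derivative[OF H gs res C assms(12)])
  \<comment> \<open>The conjugate of \<open>\<i>\<close> supplies the minus sign, and the conjugate
    of the expectation of \<open>C \<circ> B\<close> reverses the order of the operators.\<close>
  then have sum: "causation vac G A B + cnj (causation vac G A B)
       = complex_of_real \<kappa> * \<i> * expectation vac (commutator C B)"
    using expectation_hermitian_comp_commute[OF C B, of vac]
    by (simp add: expectation_def commutator_def cinner_diff_right right_diff_distrib)
  have zero: "causation vac G A B + cnj (causation vac G A B) = 0"
    if "commutator C B = (\<lambda>_. 0)"
    unfolding sum that by (simp add: expectation_def)
  \<comment> \<open>For a real number, the sum with its conjugate is twice the number.\<close>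
  have "causation vac G A B = 0"
    if "commutator C B = (\<lambda>_. 0)" and "time_reversal H T" and "same_T_charge T A B" for T
    using zero[OF that(1)]
      causation_real[OF H gs res hermitian_linear[OF A] hermitian_linear[OF B] that(2,3)]
    by simp
  then show ?thesis
    using sum zero disjoint_support_commute[OF basis C B]
      located_at_disjoint_support[OF assms(10,9)] by blast
qed

end
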